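(* Let $k$ be a positive integer. Let $A_k$ be the set of integer partitions in which no part appears more than $2k-1$ times, and let $\Phi_k$ be the map defined on $A_k$ by the construction described in the context ($\lambda \mapsto \lambda' \mapsto (\pi,\delta) \mapsto \alpha=\pi+\delta \mapsto \alpha'$). Then for every $\lambda\in A_k$ the image $\Phi_k(\lambda)$ is a partition with initial $k$-repetitions, and the map is one-to-one: if $\lambda,\mu\in A_k$ and $\Phi_k(\lambda)=\Phi_k(\mu)$, then $\lambda=\mu$.
   Context: A partition $\lambda=(\lambda_1\ge\lambda_2\ge\cdots\ge\lambda_m>0)$ is a finite weakly decreasing sequence of positive integers (possibly empty), with the convention $\lambda_i=0$ for $i>m$. Its conjugate $\lambda'$ is the partition with $\lambda'_i=\#\{j:\lambda_j\ge i\}$. A partition has initial $k$-repetitions if, whenever a part $j$ appears at least $k$ times, every positive integer less than $j$ also appears at least $k$ times as a part. $k$-strips: if $\lambda_i-\lambda_{i+1}\ge k$ (where $1\le i\le m$ and $\lambda_{m+1}=0$), one may subtract $k$ from each of the parts $\lambda_1,\dots,\lambda_i$ and still have a partition; this is called removing a $k$-strip of length $i$ (of total size $ki$). Removing all $k$-strips until none can be removed (the result does not depend on the order) decomposes $\lambda$ as a pair $(\pi,\delta)$. Here $\delta$ is the partition into multiples of $k$ recording the total amounts removed in the strips, i.e. the part $ki$ occurs in $\delta$ exactly $\lfloor(\lambda_i-\lambda_{i+1})/k\rfloor$ times. The partition $\pi$ is what remains; it is $k$-flat, meaning that $\pi_i-\pi_{i+1}<k$ for all $i\ge1$ (so in particular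 its smallest part is less than $k$). The map $\Phi_k$: given a partition $\lambda$ in which no part appears more than $2k-1$ times, (1) form the conjugate $\lambda'$; (2) remove all $k$-strips from $\lambda'$ to obtain the pair $(\pi,\delta)$, where $\delta$ is the partition in which the part $ki$ occurs exactly $\lfloor(\lambda'_i-\lambda'_{i+1})/k\rfloor$ times for each $i\ge1$ and $\pi$ is the $k$-flat partition that remains of $\lambda'$; (3) form $\alpha=\pi+\delta$ by $\alpha_i=\pi_i+\delta_i$ for all $i$, with the shorter of $\pi,\delta$ padded by zeros; (4) set $\Phi_k(\lambda)=\alpha'$, the conjugate of $\alpha$. *)

theory Defs imports Main begin

definition is_partition :: "nat list \<Rightarrow> bool" where
  "is_partition p \<longleftrightarrow> sorted_wrt (\<ge>) p \<and> (\<forall>x\<in>set p. 0 < x)"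

text \<open>One-based access with zero padding: \<open>part p i\<close> is the \<open>i\<close>-th part.\<close>
definition part :: "nat list \<Rightarrow> nat \<Rightarrow> nat" where
  "part p i = (if 1 \<le> i \<and> i \<le> length p then p ! (i - 1) else 0)"

definition conjugate :: "nat list \<Rightarrow> nat list" where
  "conjugate p = map (\<lambda>i. card {j. 1 \<le> j \<and> j \<le> length p \<and> i \<le> part p j}) [1..<part p 1 + 1]"

definition initial_repetitions :: "nat \<Rightarrow> nat list \<Rightarrow> bool" where
  "initial_repetitions k p \<longleftrightarrow>
     (\<forall>j\<in>set p. k \<le> count_list p j \<longrightarrow> (\<forall>i. 0 < i \<and> i < j \<longrightarrow> k \<le> count_list p i))"

text \<open>The filter drops the zeros that arise when the strip exhausts the last parts.\<close>
definition remove_strip :: "nat \<Rightarrow> nat \<Rightarrow> nat list \<Rightarrow> nat list" where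
  "remove_strip k i p =
     filter (\<lambda>x. 0 < x) (map (\<lambda>j. if j \<le> i then part p j - k else part p j) [1..<length p + 1])"

definition strip_step :: "nat \<Rightarrow> nat list \<Rightarrow> nat list \<Rightarrow> bool" where
  "strip_step k p q \<longleftrightarrow>
     (\<exists>i. 1 \<le> i \<and> i \<le> length p \<and> k \<le> part p i - part p (i + 1) \<and> q = remove_strip k i p)"

definition k_flat :: "nat \<Rightarrow> nat list \<Rightarrow> bool" where
  "k_flat k p \<longleftrightarrow> (\<forall>i\<ge>1. part p i - part p (i + 1) < k)"

text \<open>The remainder \<open>\<pi>\<close> after removing all \<open>k\<close>-strips in any order; it is
  well defined by \<open>flat_part_unique\<close> below.\<close>
definition flat_part :: "nat \<Rightarrow> nat list \<Rightarrow> nat list" where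
  "flat_part k p = (THE q. (strip_step k)\<^sup>*\<^sup>* p q \<and> k_flat k q)"

text \<open>The partition \<open>\<delta>\<close> of removed strips; the reversal lists the parts \<open>k * i\<close> in
  decreasing order.\<close>
definition strip_part :: "nat \<Rightarrow> nat list \<Rightarrow> nat list" where
  "strip_part k p =
     concat (map (\<lambda>i. replicate ((part p i - part p (i + 1)) div k) (k * i)) (rev [1..<length p + 1]))"

definition add_parts :: "nat list \<Rightarrow> nat list \<Rightarrow> nat list" where
  "add_parts p q = map (\<lambda>i. part p i + part q i) [1..<max (length p) (length q) + 1]"

definition Phi :: "nat \<Rightarrow> nat list \<Rightarrow> nat list" where
  "Phi k p = conjugate (add_parts (flat_part k (conjugate p)) (strip_part k (conjugate p)))"

definition restricted_partitions :: "nat \<Rightarrow> nat list set" where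
  "restricted_partitions k = {p. is_partition p \<and> (\<forall>j\<in>set p. count_list p j \<le> 2 * k - 1)}"

lemma part_Cons: "part (x # xs) j = (if j = 0 then 0 else if j = 1 then x else part xs (j - 1))"
  by (cases j) (auto simp: part_def nth_Cons split: nat.splits)

lemma part_filter_pos: "sorted_wrt (\<ge>) xs \<Longrightarrow> part (filter (\<lambda>x. 0 < x) xs) j = part xs j"
proof (induction xs arbitrary: j)
  case (Cons x xs)
  show ?case
  proof (cases "x = 0")
    case True
    with Cons.prems have z: "\<forall>y\<in>set (x # xs). y = 0" by auto
    then have "filter (\<lambda>x. 0 < x) (x # xs) = []" by (auto simp: filter_empty_conv)
    moreover have "part (x # xs) j = 0"
    proof (cases "1 \<le> j \<and> j \<le> length (x # xs)")
      case True
      then have "(x # xs) ! (j - 1) \<in> set (x # xs)" by (intro nth_mem) auto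
      with z have "(x # xs) ! (j - 1) = 0" by blast
      then show ?thesis by (simp add: part_def)
    qed (auto simp: part_def)
    ultimately show ?thesis by (simp add: part_def)
  next
    case False
    with Cons show ?thesis by (simp add: part_Cons)
  qed
qed simp

lemma part_antimono: "is_partition p \<Longrightarrow> 1 \<le> i \<Longrightarrow> i \<le> j \<Longrightarrow> part p j \<le> part p i"
  unfolding is_partition_def part_def sorted_wrt_iff_nth_less
  by (cases "i = j") auto

lemma part_pos: "is_partition p \<Longrightarrow> 1 \<le> i \<Longrightarrow> i \<le> length p \<Longrightarrow> 0 < part p i"
  by (auto simp: is_partition_def part_def)

lemma partition_eqI:
  assumes "is_partition p" "is_partition q" "\<And>i. 1 \<le> i \<Longrightarrow> part p i = part q i"
  shows "p = q"
proof -
  have len: "length a \<le> length b"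
    if "is_partition a" "\<And>i. 1 \<le> i \<Longrightarrow> part a i = part b i" for a b
  proof (rule ccontr)
    assume "\<not> length a \<le> length b"
    then have "0 < part a (length a)" "part b (length a) = 0" "1 \<le> length a"
      using part_pos[OF that(1), of "length a"] by (auto simp: part_def)
    with that(2)[of "length a"] show False by simp
  qed
  have "length p = length q" using len[of p q] len[of q p] assms by (simp add: le_antisym)
  moreover have "p ! i = q ! i" if "i < length p" for i
    using assms(3)[of "Suc i"] that calculation by (simp add: part_def)
  ultimately show ?thesis by (rule nth_equalityI)
qed

lemma remove_strip:
  assumes p: "is_partition p" and i: "1 \<le> i" "i \<le> length p"
    and k: "0 < k" "k \<le> part p i - part p (i + 1)"
  shows is_partition_remove_strip: "is_partition (remove_strip k i p)"
    and part_remove_strip: "1 \<le> j \<Longrightarrow>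
      part (remove_strip k i p) j = (if j \<le> i then part p j - k else part p j)"
proof -
  let ?f = "\<lambda>j. if j \<le> i then part p j - k else part p j"
  let ?l = "map ?f [1..<length p + 1]"
  have mono: "?f b \<le> ?f a" if "1 \<le> a" "a \<le> b" for a b
  proof (cases "a \<le> i \<and> \<not> b \<le> i")
    case True
    then have "part p b \<le> part p (i + 1)" "part p i \<le> part p a"
      using part_antimono[OF p] that by auto
    with True k show ?thesis by auto
  next
    case False
    with part_antimono[OF p that] that show ?thesis by auto
  qed
  have s: "sorted_wrt (\<ge>) ?l"
    unfolding sorted_wrt_iff_nth_less
  proof (intro allI impI)
    fix a b assume "a < b" "b < length ?l"
    then show "?l ! b \<le> ?l ! a" using mono[of "Suc a" "Suc b"] by (auto simp del: upt_Suc split: if_splits)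
  qed
  then show "is_partition (remove_strip k i p)"
    unfolding is_partition_def remove_strip_def by (auto simp: sorted_wrt_filter)
  show "part (remove_strip k i p) j = (if j \<le> i then part p j - k else part p j)" if "1 \<le> j"
  proof -
    have "part (remove_strip k i p) j = part ?l j"
      unfolding remove_strip_def by (rule part_filter_pos[OF s])
    also have "\<dots> = ?f j"
      using that i by (auto simp: part_def simp del: upt_Suc)
    finally show ?thesis .
  qed
qed

lemma strip_step_invariant:
  assumes "is_partition p" "0 < k" "strip_step k p q"
  shows "is_partition q"
    and "1 \<le> j \<Longrightarrow> (part q j - part q (j + 1)) mod k = (part p j - part p (j + 1)) mod k"
    and "part q 1 < part p 1"
proof -
  obtain i where i: "1 \<le> i" "i \<le> length p" "k \<le> part p i - part p (i + 1)"
    and q: "q = remove_strip k i p"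
    using assms(3) unfolding strip_step_def by blast
  show "is_partition q"
    unfolding q using is_partition_remove_strip assms i by blast
  have pt: "part q j = (if j \<le> i then part p j - k else part p j)" if "1 \<le> j" for j
    unfolding q using part_remove_strip assms i that by blast
  have big: "k \<le> part p j" if "1 \<le> j" "j \<le> i" for j
    using part_antimono[OF assms(1) that] i by linarith
  show "part q 1 < part p 1" using pt[of 1] big[of 1] i assms(2) by auto
  show "(part q j - part q (j + 1)) mod k = (part p j - part p (j + 1)) mod k" if "1 \<le> j"
  proof -
    consider "j < i" | "j = i" | "i < j" by linarith
    then show ?thesis
    proof cases
      case 1
      then show ?thesis using pt[of j] pt[of "j + 1"] big[of "j + 1"] that by auto
    next
      case 2
      then have "part q j - part q (j + 1) = (part p j - part p (j + 1)) - k"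
        using pt[of j] pt[of "j + 1"] that by auto
      then show ?thesis using i 2 by (simp add: le_mod_geq)
    next
      case 3
      then show ?thesis using pt[of j] pt[of "j + 1"] that by auto
    qed
  qed
qed

lemma strip_steps_invariant:
  assumes "(strip_step k)\<^sup>*\<^sup>* p q" "is_partition p" "0 < k"
  shows "is_partition q \<and>
    (\<forall>j\<ge>1. (part q j - part q (j + 1)) mod k = (part p j - part p (j + 1)) mod k)"
  using assms
proof (induction rule: rtranclp_induct)
  case (step q r)
  then show ?case using strip_step_invariant[of q k r] by simp
qed simp

lemma partition_eq_differences:
  assumes p: "is_partition p" and q: "is_partition q"
    and d: "\<And>j. 1 \<le> j \<Longrightarrow> part p j - part p (j + 1) = part q j - part q (j + 1)"
  shows "p = q"
proof (rule partition_eqI[OF p q])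
  fix i :: nat assume "1 \<le> i"
  define N where "N = Suc (max (length p) (length q))"
  have "part p i = part q i" if "N \<le> i + n" "1 \<le> i" for n i
    using that
  proof (induction n arbitrary: i)
    case 0
    then show ?case by (auto simp: part_def N_def)
  next
    case (Suc n)
    then have "part p (i + 1) = part q (i + 1)" by simp
    moreover have "part p (i + 1) \<le> part p i" "part q (i + 1) \<le> part q i"
      using part_antimono p q Suc.prems by simp_all
    ultimately show ?case using d[of i] Suc.prems by linarith
  qed
  from this[of i N] \<open>1 \<le> i\<close> show "part p i = part q i" by simp
qed

lemma flat_part_exists:
  assumes "0 < k" "is_partition p"
  shows "\<exists>q. (strip_step k)\<^sup>*\<^sup>* p q \<and> k_flat k q"
  using assms(2)
proof (induction "part p 1" arbitrary: p rule: less_induct)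
  case less
  show ?case
  proof (cases "k_flat k p")
    case False
    then obtain i where i: "1 \<le> i" "k \<le> part p i - part p (i + 1)"
      unfolding k_flat_def by (auto simp: not_less)
    with assms(1) have "i \<le> length p" by (auto simp: part_def split: if_splits)
    with i have st: "strip_step k p (remove_strip k i p)" unfolding strip_step_def by blast
    from less.hyps[OF strip_step_invariant(3,1)[OF less.prems assms(1) st]] strip_step_invariant(1)[OF less.prems assms(1) st]
    obtain q where "(strip_step k)\<^sup>*\<^sup>* (remove_strip k i p) q" "k_flat k q" by blast
    with st show ?thesis by (meson converse_rtranclp_into_rtranclp)
  qed blast
qed

lemma flat_part_unique:
  assumes "0 < k" "is_partition p"
  shows "\<exists>!q. (strip_step k)\<^sup>*\<^sup>* p q \<and> k_flat k q"
proof (rule ex_ex1I)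
  show "\<exists>q. (strip_step k)\<^sup>*\<^sup>* p q \<and> k_flat k q"
    using flat_part_exists assms by blast
next
  fix q r
  assume q: "(strip_step k)\<^sup>*\<^sup>* p q \<and> k_flat k q" and r: "(strip_step k)\<^sup>*\<^sup>* p r \<and> k_flat k r"
  note iq = strip_steps_invariant[OF conjunct1[OF q] assms(2,1)]
  note ir = strip_steps_invariant[OF conjunct1[OF r] assms(2,1)]
  show "q = r"
  proof (rule partition_eq_differences)
    fix j :: nat assume j: "1 \<le> j"
    then have "(part q j - part q (j + 1)) mod k = (part r j - part r (j + 1)) mod k"
      using iq ir by simp
    then show "part q j - part q (j + 1) = part r j - part r (j + 1)"
      using q r j by (simp add: k_flat_def)
  qed (use iq ir in auto)
qed

end

(* The multiplicity of i in a partition is the i-th difference of its conjugate. The i-th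
   difference of pi is the residue mod k of that of the conjugate of lambda, while all parts of
   delta are multiples of k; hence the differences of alpha = pi + delta reduced mod k recover pi,
   and then delta = alpha - pi. The multiplicities of delta are the quotients lost in pi, so lambda
   is recovered. Multiplicities below 2k in lambda make the parts of delta distinct, so the i-th
   difference of alpha is at least k precisely for i up to the number of parts of delta. *)
theory Submission imports Defs begin

section \<open>Conjugation\<close>

lemma part_map_upt:
  "1 \<le> i \<Longrightarrow> part (map f [1..<n + 1]) i = (if i \<le> n then f i else 0)"
  by (simp add: part_def del: upt_Suc)

text \<open>The parts weakly decrease, so the counted indices form an initial segment
  \<open>{1..m}\<close>, which has at least \<open>i\<close> elements iff it contains
  \<open>i\<close>. As \<open>j\<close> is positive, the zero padding never counts.\<close>

lemma part_ge_iff_le_card: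
  assumes "is_partition p" "1 \<le> i" "1 \<le> j"
  shows "i \<le> card {l. 1 \<le> l \<and> l \<le> length p \<and> j \<le> part p l} \<longleftrightarrow> j \<le> part p i"
    (is "i \<le> card ?A \<longleftrightarrow> _")
proof
  have fin: "finite ?A" by (rule finite_subset[of _ "{..length p}"]) auto
  show "i \<le> card ?A" if j: "j \<le> part p i"
  proof -
    have "i \<le> length p" using assms j by (auto simp: part_def split: if_splits)
    then have "{1..i} \<subseteq> ?A"
      using part_antimono[OF assms(1)] j by (auto intro: order_trans)
    from card_mono[OF fin this] show ?thesis by simp
  qed
  show "j \<le> part p i" if i: "i \<le> card ?A"
  proof (rule ccontr)
    assume "\<not> j \<le> part p i"
    then have "?A \<subseteq> {1..<i}"
      using part_antimono[OF assms(1,2)] by (force simp: not_le[symmetric])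
    from card_mono[OF _ this] i assms(2) show False by simp
  qed
qed

lemma length_conjugate [simp]: "length (conjugate p) = part p 1"
  by (simp add: conjugate_def)

lemma part_conjugate:
  assumes "is_partition p" "1 \<le> i"
  shows "part (conjugate p) i = card {j. 1 \<le> j \<and> j \<le> length p \<and> i \<le> part p j}"
proof (cases "i \<le> part p 1")
  case True
  with assms(2) show ?thesis
    unfolding conjugate_def part_map_upt[OF assms(2)] by simp
next
  case False
  then have "part (conjugate p) i = 0" by (simp add: part_def[of "conjugate p"])
  \<comment> \<open>Past the end of the list the padding is 0, and the count is 0 too: not even the
    largest part reaches \<open>i\<close>.\<close>
  moreover have "\<not> 1 \<le> card {j. 1 \<le> j \<and> j \<le> length p \<and> i \<le> part p j}"
    using part_ge_iff_le_card[OF assms(1), of 1 i] assms(2) False by blast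
  ultimately show ?thesis by linarith
qed

text \<open>Reflection of the Young diagram: both sides say that the cell in row \<open>i\<close>
  and column \<open>j\<close> belongs to the diagram of \<open>p\<close>.\<close>

lemma le_part_conjugate_iff:
  assumes "is_partition p" "1 \<le> i" "1 \<le> j"
  shows "i \<le> part (conjugate p) j \<longleftrightarrow> j \<le> part p i"
  using assms by (simp add: part_conjugate part_ge_iff_le_card[simplified])

lemma is_partitionI:
  assumes "\<And>i j. 1 \<le> i \<Longrightarrow> i \<le> j \<Longrightarrow> part p j \<le> part p i"
    and "\<And>i. 1 \<le> i \<Longrightarrow> i \<le> length p \<Longrightarrow> 0 < part p i"
  shows "is_partition p"
proof -
  have "p ! j \<le> p ! i" if "i < j" "j < length p" for i j
    using assms(1)[of "Suc i" "Suc j"] that by (simp add: part_def)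
  moreover have "0 < p ! i" if "i < length p" for i
    using assms(2)[of "Suc i"] that by (simp add: part_def)
  ultimately show ?thesis
    unfolding is_partition_def sorted_wrt_iff_nth_less by (auto simp: in_set_conv_nth)
qed

lemma is_partition_conjugate:
  assumes "is_partition p"
  shows "is_partition (conjugate p)"
proof (rule is_partitionI)
  fix i j :: nat assume ij: "1 \<le> i" "i \<le> j"
  show "part (conjugate p) j \<le> part (conjugate p) i"
  proof (cases "part (conjugate p) j = 0")
    \<comment> \<open>The cell in row \<open>part (conjugate p) j\<close> and column
      \<open>j\<close> lies in the diagram, hence so does the cell of that row in column
      \<open>i\<close>. The cell criterion needs a positive row, so the value 0 is split
      off.\<close>
    case False
    with ij le_part_conjugate_iff[OF assms, of "part (conjugate p) j"] show ?thesis
      by (meson le_refl le_trans less_one not_le)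
  qed simp
next
  fix i assume "1 \<le> i" "i \<le> length (conjugate p)"
  with le_part_conjugate_iff[OF assms, of 1 i] show "0 < part (conjugate p) i" by simp
qed

lemma conjugate_conjugate:
  assumes "is_partition p"
  shows "conjugate (conjugate p) = p"
proof (rule partition_eqI)
  fix i :: nat assume i: "1 \<le> i"
  note c = is_partition_conjugate[OF assms]
  show "part (conjugate (conjugate p)) i = part p i"
  \<comment> \<open>Each inequality applies the cell criterion twice, with its left-hand side as row
    index when that is positive.\<close>
  proof (rule antisym)
    show "part (conjugate (conjugate p)) i \<le> part p i"
      using i le_part_conjugate_iff[OF c, of "part (conjugate (conjugate p)) i" i]
        le_part_conjugate_iff[OF assms i, of "part (conjugate (conjugate p)) i"]
      by (cases "part (conjugate (conjugate p)) i = 0") auto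
    show "part p i \<le> part (conjugate (conjugate p)) i"
      using i le_part_conjugate_iff[OF c, of "part p i" i]
        le_part_conjugate_iff[OF assms i, of "part p i"]
      by (cases "part p i = 0") auto
  qed
qed (use assms is_partition_conjugate in auto)

text \<open>The parts equal to \<open>i\<close> are those that are at least \<open>i\<close> but not
  at least \<open>i + 1\<close>; these two index sets are nested, so their cardinalities
  subtract.\<close>

lemma count_list_eq_conjugate_diff:
  assumes "is_partition p" "1 \<le> i"
  shows "count_list p i = part (conjugate p) i - part (conjugate p) (i + 1)"
proof -
  let ?A = "\<lambda>i. {j. 1 \<le> j \<and> j \<le> length p \<and> i \<le> part p j}"
  have "count_list p i = card {j. j < length p \<and> p ! j = i}"
    by (simp add: count_list_eq_length_filter length_filter_conv_card eq_commute)
  \<comment> \<open>\<open>Suc\<close> passes from zero-based list positions to the one-based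
    indices of \<open>part\<close>.\<close>
  also have "\<dots> = card (Suc ` {j. j < length p \<and> p ! j = i})"
    by (simp add: card_image)
  also have "Suc ` {j. j < length p \<and> p ! j = i} = ?A i - ?A (i + 1)"
  proof (intro equalityI subsetI)
    fix x assume "x \<in> ?A i - ?A (i + 1)"
    then show "x \<in> Suc ` {j. j < length p \<and> p ! j = i}"
      by (intro image_eqI[of _ _ "x - 1"]) (auto simp: part_def)
  qed (auto simp: part_def)
  also have "card \<dots> = card (?A i) - card (?A (i + 1))"
    by (rule card_Diff_subset) (auto intro: finite_subset[of _ "{..length p}"])
  finally show ?thesis using assms by (simp add: part_conjugate)
qed

text \<open>The dual form, for reading multiplicities in \<open>Phi k p\<close>, which is itself a
  conjugate.\<close>

lemma count_list_conjugate:
  assumes "is_partition p" "1 \<le> i"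
  shows "count_list (conjugate p) i = part p i - part p (i + 1)"
  using count_list_eq_conjugate_diff[OF is_partition_conjugate] conjugate_conjugate assms
  by simp

section \<open>Sums of partitions and removal of strips\<close>

lemma length_add_parts: "length (add_parts p q) = max (length p) (length q)"
  by (simp add: add_parts_def del: upt_Suc)

lemma part_add_parts:
  "1 \<le> i \<Longrightarrow> part (add_parts p q) i = part p i + part q i"
  unfolding add_parts_def by (subst part_map_upt) (auto simp: part_def)

lemma is_partition_add_parts:
  assumes "is_partition p" "is_partition q"
  shows "is_partition (add_parts p q)"
proof (rule is_partitionI)
  fix i assume "1 \<le> i" "i \<le> length (add_parts p q)"
  then show "0 < part (add_parts p q) i"
    using part_pos[OF assms(1)] part_pos[OF assms(2)]
    by (fastforce simp: part_add_parts length_add_parts le_max_iff_disj)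
qed (use part_antimono assms in \<open>simp add: part_add_parts add_mono\<close>)

text \<open>Removing a strip lowers a single difference by \<open>k\<close>, so residues survive;
  flatness makes each final difference equal to its residue. Later arguments use these differences
  in place of the description by \<open>THE\<close>.\<close>

lemma flat_part:
  assumes "0 < k" "is_partition p"
  shows is_partition_flat_part: "is_partition (flat_part k p)"
    and flat_part_diff: "1 \<le> i \<Longrightarrow>
      part (flat_part k p) i - part (flat_part k p) (i + 1) = (part p i - part p (i + 1)) mod k"
proof -
  have fp: "(strip_step k)\<^sup>*\<^sup>* p (flat_part k p)" "k_flat k (flat_part k p)"
    using theI'[OF flat_part_unique[OF assms]] unfolding flat_part_def by auto
  note inv = strip_steps_invariant[OF fp(1) assms(2,1)]
  show "is_partition (flat_part k p)" using inv by simp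
  show "part (flat_part k p) i - part (flat_part k p) (i + 1) = (part p i - part p (i + 1)) mod k"
    if "1 \<le> i"
    using inv fp(2) that by (metis k_flat_def mod_less)
qed

text \<open>The list behind \<open>strip_part\<close>, generalized to arbitrary multiplicities
  \<open>f\<close> and a decreasing index list so that induction on the list applies. Since
  \<open>k\<close> is positive, blocks of different indices have different values.\<close>

lemma concat_replicate_sorted:
  fixes xs :: "nat list"
  assumes "0 < k" "sorted_wrt (>) xs"
  shows "sorted_wrt (\<ge>) (concat (map (\<lambda>i. replicate (f i) (k * i)) xs))"
    and "(\<And>i. f i \<le> 1) \<Longrightarrow> sorted_wrt (>) (concat (map (\<lambda>i. replicate (f i) (k * i)) xs))"
    and "count_list (concat (map (\<lambda>i. replicate (f i) (k * i)) xs)) (k * j)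
      = (if j \<in> set xs then f j else 0)"
proof -
  have ge: "sorted_wrt (\<ge>) (replicate n y)" for n and y :: nat
    by (simp add: sorted_wrt_iff_nth_less)
  show "sorted_wrt (\<ge>) (concat (map (\<lambda>i. replicate (f i) (k * i)) xs))"
    using assms(2) ge by (induction xs) (auto simp: sorted_wrt_append less_imp_le)
  show "sorted_wrt (>) (concat (map (\<lambda>i. replicate (f i) (k * i)) xs))"
    if f: "\<And>i. f i \<le> 1"
  proof -
    have gt: "sorted_wrt (>) (replicate (f i) y)" for i and y :: nat
      using f[of i] by (auto simp: sorted_wrt_iff_nth_less)
    show ?thesis
      using assms gt by (induction xs) (auto simp: sorted_wrt_append)
  qed
  have cr: "count_list (replicate n y) z = (if y = z then n else 0)" for n and y z :: nat
    by (induction n) auto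
  show "count_list (concat (map (\<lambda>i. replicate (f i) (k * i)) xs)) (k * j)
      = (if j \<in> set xs then f j else 0)"
    using assms by (induction xs) (auto simp: cr)
qed

lemma dvd_strip_part: "x \<in> set (strip_part k p) \<Longrightarrow> k dvd x"
  by (auto simp: strip_part_def)

lemma sorted_wrt_rev_upt: "sorted_wrt (>) (rev [m..<n])"
  by (simp add: sorted_wrt_rev)

lemma is_partition_strip_part:
  assumes "0 < k"
  shows "is_partition (strip_part k p)"
  using concat_replicate_sorted(1)[OF assms sorted_wrt_rev_upt] assms
  by (auto simp: is_partition_def strip_part_def simp del: upt_Suc)

text \<open>A difference below \<open>2 * k\<close> has quotient at most 1, so no strip length is
  removed twice.\<close>

lemma strip_part_strict:
  assumes "0 < k" "\<And>i. part p i - part p (i + 1) < 2 * k"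
  shows "sorted_wrt (>) (strip_part k p)"
  unfolding strip_part_def
proof (rule concat_replicate_sorted(2)[OF assms(1) sorted_wrt_rev_upt])
  show "(part p i - part p (i + 1)) div k \<le> 1" for i
    using less_mult_imp_div_less[OF assms(2)[of i]] by simp
qed

lemma count_list_strip_part:
  assumes "0 < k" "1 \<le> i"
  shows "count_list (strip_part k p) (k * i) = (part p i - part p (i + 1)) div k"
  unfolding strip_part_def concat_replicate_sorted(3)[OF assms(1) sorted_wrt_rev_upt]
  \<comment> \<open>An \<open>i\<close> beyond \<open>length p\<close> is not in the index list and
    has count 0, matching the padded difference 0.\<close>
  using assms(2) by (auto simp: part_def simp del: upt_Suc)

lemma dvd_part_strip_part: "k dvd part (strip_part k p) i"
  by (auto simp: part_def intro!: dvd_strip_part[of _ k p])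

text \<open>The parts are distinct multiples of \<open>k\<close>, so neighbours differ by at least
  \<open>k\<close>, and so does the last part from the padding 0. Beyond the list all differences
  vanish.\<close>

lemma strip_part_diff:
  assumes "0 < k" "\<And>i. part p i - part p (i + 1) < 2 * k" "1 \<le> i"
  shows "k \<le> part (strip_part k p) i - part (strip_part k p) (i + 1)
    \<longleftrightarrow> i \<le> length (strip_part k p)"
proof
  let ?d = "strip_part k p"
  show "i \<le> length ?d" if "k \<le> part ?d i - part ?d (i + 1)"
    using that assms by (auto simp: part_def split: if_splits)
  assume i: "i \<le> length ?d"
  have "part ?d (i + 1) < part ?d i"
  \<comment> \<open>The last part is compared with the padding 0, so positivity takes the place of
    strictness.\<close>
  proof (cases "i = length ?d")
    case True
    then show ?thesis
      using part_pos[OF is_partition_strip_part[OF assms(1)] assms(3) i] by (simp add: part_def)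
  next
    case False
    with i sorted_wrt_nth_less[OF strip_part_strict[OF assms(1,2)], of "i - 1" i] assms(3)
    show ?thesis by (simp add: part_def)
  qed
  then show "k \<le> part ?d i - part ?d (i + 1)"
    using dvd_part_strip_part[of k p] by (intro dvd_imp_le dvd_diff_nat) auto
qed

text \<open>Subtraction on \<open>nat\<close> truncates; weak decrease of both partitions makes the
  differences genuine, and so additive.\<close>

lemma add_parts_diff:
  assumes "is_partition p" "is_partition q" "1 \<le> i"
  shows "part (add_parts p q) i - part (add_parts p q) (i + 1)
    = (part p i - part p (i + 1)) + (part q i - part q (i + 1))"
  using part_antimono[OF assms(1,3), of "i + 1"] part_antimono[OF assms(2,3), of "i + 1"] assms(3)
  by (simp add: part_add_parts)

section \<open>The map\<close>

lemma inj_on_add_flat_strip: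
  assumes "0 < k"
  shows "inj_on (\<lambda>p. add_parts (flat_part k p) (strip_part k p)) {p. is_partition p}"
proof (rule inj_onI, unfold mem_Collect_eq)
  fix p q
  assume p: "is_partition p" and q: "is_partition q"
    and eq: "add_parts (flat_part k p) (strip_part k p)
      = add_parts (flat_part k q) (strip_part k q)"
  have *: "(part (add_parts (flat_part k r) (strip_part k r)) i
      - part (add_parts (flat_part k r) (strip_part k r)) (i + 1)) mod k
      = (part r i - part r (i + 1)) mod k"
    if r: "is_partition r" and i: "1 \<le> i" for r i
  proof -
    \<comment> \<open>The strips contribute a multiple of \<open>k\<close> to each difference, which
      disappears modulo \<open>k\<close>.\<close>
    have "k dvd part (strip_part k r) i - part (strip_part k r) (i + 1)"
      by (intro dvd_diff_nat dvd_part_strip_part)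
    then show ?thesis
      unfolding add_parts_diff[OF is_partition_flat_part[OF assms r]
          is_partition_strip_part[OF assms] i] flat_part_diff[OF assms r i]
      by auto
  qed
  have m: "(part p i - part p (i + 1)) mod k = (part q i - part q (i + 1)) mod k"
    if "1 \<le> i" for i
    using *[OF p that] *[OF q that] eq by simp
  then have "flat_part k p = flat_part k q"
    using flat_part_diff[OF assms p] flat_part_diff[OF assms q]
    by (intro partition_eq_differences is_partition_flat_part assms p q) simp
  \<comment> \<open>The common flat part is cancelled from the two equal sums.\<close>
  then have "part (strip_part k p) i = part (strip_part k q) i" if "1 \<le> i" for i
    using arg_cong[OF eq, of "\<lambda>r. part r i"] that by (simp add: part_add_parts)
  then have s: "strip_part k p = strip_part k q"
    by (intro partition_eqI is_partition_strip_part assms)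
  show "p = q"
  proof (rule partition_eq_differences[OF p q])
    fix i :: nat assume i: "1 \<le> i"
    show "part p i - part p (i + 1) = part q i - part q (i + 1)"
      \<comment> \<open>The multiplicity of \<open>k * i\<close> in the strip part is the quotient
        of the difference by \<open>k\<close>, and \<open>m\<close> gives the remainder; together
        they determine the difference.\<close>
      using m[OF i] count_list_strip_part[OF assms i, of p] count_list_strip_part[OF assms i, of q] s
      by (metis div_mod_decomp)
  qed
qed

lemma is_partition_add_flat_strip:
  "0 < k \<Longrightarrow> is_partition p \<Longrightarrow> is_partition (add_parts (flat_part k p) (strip_part k p))"
  by (intro is_partition_add_parts is_partition_flat_part is_partition_strip_part)

text \<open>\<open>Phi k\<close> is the injective sum map between two conjugations, and conjugation
  is an involution on partitions.\<close>

lemma inj_on_Phi: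
  assumes "0 < k"
  shows "inj_on (Phi k) {p. is_partition p}"
proof (rule inj_onI, unfold mem_Collect_eq)
  fix p q assume p: "is_partition p" and q: "is_partition q" and eq: "Phi k p = Phi k q"
  note c = is_partition_conjugate[OF p] is_partition_conjugate[OF q]
  have inv: "conjugate (Phi k r) = add_parts (flat_part k (conjugate r)) (strip_part k (conjugate r))"
    if "is_partition r" for r
    unfolding Phi_def
    by (intro conjugate_conjugate is_partition_add_flat_strip is_partition_conjugate assms that)
  have "conjugate p = conjugate q"
    by (rule inj_onD[OF inj_on_add_flat_strip[OF assms]])
      (use c in \<open>simp_all add: inv[OF p, symmetric] inv[OF q, symmetric] eq\<close>)
  from arg_cong[OF this, of conjugate] show "p = q"
    unfolding conjugate_conjugate[OF p] conjugate_conjugate[OF q] .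
qed

text \<open>The positive integers occurring at least \<open>k\<close> times in the image are exactly
  \<open>1\<close> to the number of strips removed, a downward closed set.\<close>

lemma initial_repetitions_Phi:
  assumes "0 < k" "p \<in> restricted_partitions k"
  shows "initial_repetitions k (Phi k p)"
proof -
  let ?c = "conjugate p"
  let ?d = "strip_part k ?c"
  have p: "is_partition p" using assms(2) by (simp add: restricted_partitions_def)
  have m: "count_list p j \<le> 2 * k - 1" for j
    using assms(2) by (cases "j \<in> set p") (auto simp: restricted_partitions_def count_list_0_iff)
  note c = is_partition_conjugate[OF p]
  have small: "part ?c i - part ?c (i + 1) < 2 * k" for i
    using count_list_eq_conjugate_diff[OF p, of i] m[of i] assms(1)
    \<comment> \<open>At \<open>i = 0\<close> the padded \<open>part ?c 0\<close> is 0, so the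
      truncated difference is 0.\<close>
    by (cases "i = 0") (auto simp: part_def[of _ 0])
  have iff: "k \<le> count_list (Phi k p) i \<longleftrightarrow> i \<le> length ?d" if i: "1 \<le> i" for i
  proof -
    have eq: "count_list (Phi k p) i
      = (part ?c i - part ?c (i + 1)) mod k + (part ?d i - part ?d (i + 1))"
      unfolding Phi_def
      using count_list_conjugate[OF is_partition_add_flat_strip[OF assms(1) c] i]
        add_parts_diff[OF is_partition_flat_part[OF assms(1) c] is_partition_strip_part[OF assms(1)] i]
        flat_part_diff[OF assms(1) c i]
      by simp
    show ?thesis
    \<comment> \<open>The residue is below \<open>k\<close>, so the strip difference decides: it is
      at least \<open>k\<close> in the first case and 0 in the second.\<close>
    proof (cases "i \<le> length ?d")
      case True
      with strip_part_diff[OF assms(1) small i] eq show ?thesis by simp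
    next
      case False
      then have "part ?d i - part ?d (i + 1) = 0" by (simp add: part_def)
      with eq False assms(1) show ?thesis by (simp add: not_le)
    qed
  qed
  show ?thesis
    unfolding initial_repetitions_def
  proof (intro ballI impI allI)
    fix j i assume "k \<le> count_list (Phi k p) j" "0 < i \<and> i < j"
    with iff[of i] iff[of j] show "k \<le> count_list (Phi k p) i" by simp
  qed
qed

theorem theorem1:
  fixes k :: nat
  assumes "0 < k"
  shows "(\<forall>p\<in>restricted_partitions k. is_partition (Phi k p) \<and> initial_repetitions k (Phi k p))
    \<and> inj_on (Phi k) (restricted_partitions k)"
proof (intro conjI ballI)
  fix p assume p: "p \<in> restricted_partitions k"
  then show "is_partition (Phi k p)"
    unfolding Phi_def restricted_partitions_def
    by (auto intro!: is_partition_conjugate is_partition_add_flat_strip assms)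
  show "initial_repetitions k (Phi k p)"
    by (rule initial_repetitions_Phi[OF assms p])
next
  show "inj_on (Phi k) (restricted_partitions k)"
    by (rule inj_on_subset[OF inj_on_Phi[OF assms]]) (auto simp: restricted_partitions_def)
qed

end
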